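(* Let $f = \sum_{S\subseteq [n]} a_S x^S \in \mathbb{R}[x_1,\dots,x_n]$ be a multiaffine polynomial, and consider the map $\sigma: \operatorname{supp}(f) \to \{\pm 1\}$ given by $S \mapsto \operatorname{sign}(a_S)$. If $f$ is real stable and $a_{\varnothing} > 0$, then $\sigma$ is an orientation of $\operatorname{supp}(f)$ with respect to $\varnothing$.
   Context: Notation: $[n]=\{1,\dots,n\}$; for $S\subseteq[n]$, $x^S=\prod_{i\in S}x_i$ and $e_S\in\{0,1\}^n$ is the indicator vector of $S$; $X\Delta Y$ denotes symmetric difference. A polynomial is multiaffine if it has degree at most one in each variable. For a multiaffine polynomial $f=\sum_{S\subseteq[n]} a_Sx^S$, $\operatorname{supp}(f)=\{S\subseteq[n] : a_S\neq 0\}$. A polynomial $f\in\mathbb{C}[x_1,\dots,x_n]$ is stable if $f(z_1,\dots,z_n)\neq 0$ whenever $\operatorname{Im}(z_1),\dots,\operatorname{Im}(z_n)>0$; it is real stable if in addition it has real coefficients. A $\Delta$-matroid is a nonempty collection $\mathcal{B}\subseteq 2^{[n]}$ such that for any $X,Y\in\mathcal{B}$ and any $i\in X\Delta Y$ there exists $j\in X\Delta Y$ (possibly $j=i$) with $X\Delta\{i,j\}\in\mathcal{B}$. Elements of $\mathcal{B}$ are called bases. Its polytope is $P_{\mathcal{B}}=\operatorname{conv}\{e_B : B\in\mathcal{B}\}$. All edges of a $\Delta$-matroid polytope have $\ell_1$-length one or two; an edge $[e_A,e_B]$ of $P_{\mathcal{B}}$ is called long if its $\ell_1$-length is two, i.e.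 $|A\Delta B|=2$. Fix a reference basis $F\in\mathcal{B}$. A long edge $[e_A,e_B]$ of $P_{\mathcal{B}}$ is horizontal (with respect to $F$) if $|A\Delta F|=|B\Delta F|$, and vertical (with respect to $F$) otherwise. A function $s_F:\mathcal{B}\to\{\pm1\}$ is an orientation of $\mathcal{B}$ with respect to $F\in\mathcal{B}$ if: (1) $\mathcal{B}$ is a $\Delta$-matroid; (2) if $[e_A,e_B]$ is a horizontal long edge of $P_{\mathcal{B}}$ relative to $F$, then $s_F(A)=s_F(B)$; (3) if $[e_A,e_B]$ is a vertical long edge of $P_{\mathcal{B}}$ relative to $F$, then $s_F(A)=-s_F(B)$; (4) for every two-dimensional face of the hypercube $[0,1]^n$ all four of whose vertices correspond to bases, if three of the vertices have the same sign under $s_F$ and the fourth has the opposite sign, then the vertex with the opposite sign is either the closest or the furthest vertex of that face from $F$ (distance between $A$ and $F$ being $|A\Delta F|$); (5) $s_F(F)=+1$. *)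

theory Defs
  imports "HOL-Analysis.Analysis" "HOL-Library.Poly_Mapping"
begin

text \<open>
  The index set $[n]$ is an arbitrary finite type \<open>'n\<close>. A polynomial with coefficients in \<open>'a\<close> and
  variables indexed by \<open>'n\<close> is an element of the library's monoid ring: a finitely supported map
  from exponent vectors \<open>'n \<Rightarrow>\<^sub>0 nat\<close> to coefficients.
\<close>

type_synonym ('n, 'a) mpolynomial = "('n \<Rightarrow>\<^sub>0 nat) \<Rightarrow>\<^sub>0 'a"

definition mpoly_eval :: "('n, 'a::comm_semiring_1) mpolynomial \<Rightarrow> ('n \<Rightarrow> 'a) \<Rightarrow> 'a" where
  "mpoly_eval f z =
    (\<Sum>m\<in>Poly_Mapping.keys f.
       Poly_Mapping.lookup f m * (\<Prod>i\<in>Poly_Mapping.keys m. z i ^ Poly_Mapping.lookup m i))"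

definition multiaffine :: "('n, 'a::zero) mpolynomial \<Rightarrow> bool" where
  "multiaffine f \<longleftrightarrow> (\<forall>m\<in>Poly_Mapping.keys f. \<forall>i. Poly_Mapping.lookup m i \<le> 1)"

text \<open>The exponent vector of the monomial $x^S = \prod_{i \in S} x_i$, and its coefficient $a_S$.\<close>

definition sqfree_exponent :: "'n set \<Rightarrow> 'n \<Rightarrow>\<^sub>0 nat" where
  "sqfree_exponent S = (\<Sum>i\<in>S. Poly_Mapping.single i 1)"

definition coeff_of :: "('n, 'a::zero) mpolynomial \<Rightarrow> 'n set \<Rightarrow> 'a" where
  "coeff_of f S = Poly_Mapping.lookup f (sqfree_exponent S)"

definition supp :: "('n, 'a::zero) mpolynomial \<Rightarrow> 'n set set" where
  "supp f = {S. coeff_of f S \<noteq> 0}"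

definition stable :: "('n, complex) mpolynomial \<Rightarrow> bool" where
  "stable f \<longleftrightarrow> (\<forall>z. (\<forall>i. Im (z i) > 0) \<longrightarrow> mpoly_eval f z \<noteq> 0)"

definition real_stable :: "('n, complex) mpolynomial \<Rightarrow> bool" where
  "real_stable f \<longleftrightarrow> stable f \<and> (\<forall>m. Poly_Mapping.lookup f m \<in> \<real>)"

definition delta_matroid :: "'n set set \<Rightarrow> bool" where
  "delta_matroid \<B> \<longleftrightarrow>
     \<B> \<noteq> {} \<and>
     (\<forall>X\<in>\<B>. \<forall>Y\<in>\<B>. \<forall>i\<in>sym_diff X Y. \<exists>j\<in>sym_diff X Y. sym_diff X {i, j} \<in> \<B>)"

definition indicator_vec :: "'n::finite set \<Rightarrow> real ^ 'n" where
  "indicator_vec S = (\<chi> i. if i \<in> S then 1 else 0)"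

definition base_polytope :: "'n::finite set set \<Rightarrow> (real ^ 'n) set" where
  "base_polytope \<B> = convex hull (indicator_vec ` \<B>)"

definition set_dist :: "'n set \<Rightarrow> 'n set \<Rightarrow> nat" where
  "set_dist A B = card (sym_diff A B)"

text \<open>The $\ell_1$-length of the segment $[e_A, e_B]$ is \<open>set_dist A B\<close>.\<close>

definition long_edge :: "'n::finite set set \<Rightarrow> 'n set \<Rightarrow> 'n set \<Rightarrow> bool" where
  "long_edge \<B> A B \<longleftrightarrow>
     A \<in> \<B> \<and> B \<in> \<B> \<and>
     closed_segment (indicator_vec A) (indicator_vec B) edge_of base_polytope \<B> \<and>
     set_dist A B = 2"

definition horizontal_edge :: "'n::finite set set \<Rightarrow> 'n set \<Rightarrow> 'n set \<Rightarrow> 'n set \<Rightarrow> bool" where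
  "horizontal_edge \<B> F A B \<longleftrightarrow> long_edge \<B> A B \<and> set_dist A F = set_dist B F"

definition vertical_edge :: "'n::finite set set \<Rightarrow> 'n set \<Rightarrow> 'n set \<Rightarrow> 'n set \<Rightarrow> bool" where
  "vertical_edge \<B> F A B \<longleftrightarrow> long_edge \<B> A B \<and> set_dist A F \<noteq> set_dist B F"

definition two_face :: "(real ^ 'n::finite) set \<Rightarrow> bool" where
  "two_face Q \<longleftrightarrow> Q face_of cbox 0 1 \<and> aff_dim Q = 2"

definition face_vertices :: "(real ^ 'n::finite) set \<Rightarrow> 'n set set" where
  "face_vertices Q = {S. indicator_vec S extreme_point_of Q}"

text \<open>
  A sign function on \<open>\<B>\<close> is a total function into the reals of which only the values on \<open>\<B>\<close> matter.
  The last conjunct: on a two-dimensional face of the cube with all vertices in \<open>\<B>\<close>, a vertex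
  \<open>A\<close> whose sign is opposite to that of the other three minimizes or maximizes the distance
  to \<open>F\<close> over the vertices of the face. (The distances on such a face are $d, d+1, d+1, d+2$,
  so minimizer and maximizer are unique.)
\<close>

definition is_orientation :: "'n::finite set set \<Rightarrow> 'n set \<Rightarrow> ('n set \<Rightarrow> real) \<Rightarrow> bool" where
  "is_orientation \<B> F s \<longleftrightarrow>
     F \<in> \<B> \<and> (\<forall>S\<in>\<B>. s S \<in> {1, -1}) \<and>
     delta_matroid \<B> \<and>
     (\<forall>A B. horizontal_edge \<B> F A B \<longrightarrow> s A = s B) \<and>
     (\<forall>A B. vertical_edge \<B> F A B \<longrightarrow> s A = - s B) \<and>
     s F = 1 \<and>
     (\<forall>Q. two_face Q \<and> face_vertices Q \<subseteq> \<B> \<longrightarrow>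
        (\<forall>A\<in>face_vertices Q.
           (\<forall>C\<in>face_vertices Q - {A}. s C = - s A) \<longrightarrow>
             (\<forall>C\<in>face_vertices Q. set_dist A F \<le> set_dist C F) \<or>
             (\<forall>C\<in>face_vertices Q. set_dist C F \<le> set_dist A F)))"

end

theory Submission
  imports Defs "HOL-Computational_Algebra.Polynomial"
begin

text \<open>
  Write \<open>f = G + x\<^sub>i H\<close> with \<open>G\<close>, \<open>H\<close> free of \<open>x\<^sub>i\<close>. Since \<open>x\<^sub>i = - G / H\<close> is a zero of \<open>f\<close>, stability
  means that \<open>Im (G * cnj H) \<ge> 0\<close> on the upper half-space, hence by continuity on its closure.
  Replacing \<open>x\<^sub>k\<close> by \<open>- 1 / x\<^sub>k\<close> for all \<open>k \<in> X\<close> preserves stability and moves the coefficient of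
  \<open>x\<^sup>X\<close> to the constant term, so it suffices to argue at the origin. There, the choice \<open>x\<^sub>j = \<i>\<close>
  and \<open>x\<^sub>k = 0\<close> otherwise gives \<open>a\<^sub>S\<^sub>i a\<^sub>S\<^sub>j \<ge> a\<^sub>S a\<^sub>S\<^sub>i\<^sub>j\<close>, from which all sign conditions follow. For the
  exchange axiom put \<open>x\<^sub>k = t\<close> on the symmetric difference: if the axiom fails, \<open>H\<close> vanishes
  to order at least two at \<open>t = 0\<close> while \<open>G\<close> does not vanish there, and \<open>Im (G * cnj H)\<close> changes sign.
\<close>

section \<open>Stability as a sign condition on deletion and contraction\<close>

definition mval :: "('n::finite set \<Rightarrow> real) \<Rightarrow> ('n \<Rightarrow> complex) \<Rightarrow> complex" where
  "mval a z = (\<Sum>S\<in>UNIV. of_real (a S) * (\<Prod>k\<in>S. z k))"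

definition mval_del :: "('n::finite set \<Rightarrow> real) \<Rightarrow> 'n \<Rightarrow> ('n \<Rightarrow> complex) \<Rightarrow> complex" where
  "mval_del a i z = (\<Sum>S | i \<notin> S. of_real (a S) * (\<Prod>k\<in>S. z k))"

definition mval_contr :: "('n::finite set \<Rightarrow> real) \<Rightarrow> 'n \<Rightarrow> ('n \<Rightarrow> complex) \<Rightarrow> complex" where
  "mval_contr a i z = (\<Sum>S | i \<notin> S. of_real (a (insert i S)) * (\<Prod>k\<in>S. z k))"

definition stable_coeffs :: "('n::finite set \<Rightarrow> real) \<Rightarrow> bool" where
  "stable_coeffs a \<longleftrightarrow> (\<forall>z. (\<forall>i. Im (z i) > 0) \<longrightarrow> mval a z \<noteq> 0)"

text \<open>These are the coefficients after substituting \<open>- 1 / x k\<close> for all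
  \<open>k\<close> in \<open>X\<close> and clearing denominators by the product of the
  \<open>x k\<close>. The term of \<open>S\<close> lands on \<open>T = sym_diff S X\<close>, and
  each element of \<open>S \<inter> X = X - T\<close> contributes a factor -1.\<close>

definition flip_coeffs :: "'n::finite set \<Rightarrow> ('n set \<Rightarrow> real) \<Rightarrow> 'n set \<Rightarrow> real" where
  "flip_coeffs X a T = (-1) ^ card (X - T) * a (sym_diff T X)"

lemma mval_split: "mval a z = mval_del a i z + z i * mval_contr a i z"
proof -
  have "(\<Sum>S | i \<in> S. of_real (a S) * (\<Prod>k\<in>S. z k)) =
        (\<Sum>S | i \<notin> S. of_real (a (insert i S)) * (\<Prod>k\<in>insert i S. z k))"
    by (rule sum.reindex_bij_witness[of _ "insert i" "\<lambda>S. S - {i}"]) (auto simp: insert_absorb)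
  also have "\<dots> = z i * mval_contr a i z"
    by (auto simp: mval_contr_def sum_distrib_left intro!: sum.cong)
  moreover have "mval a z = mval_del a i z + (\<Sum>S | i \<in> S. of_real (a S) * (\<Prod>k\<in>S. z k))"
    unfolding mval_def mval_del_def
    by (subst sum.union_disjoint[symmetric]) (auto intro!: sum.cong)
  ultimately show ?thesis by simp
qed

lemma mval_del_upd: "mval_del a i (z(i := w)) = mval_del a i z"
  unfolding mval_del_def
  by (intro sum.cong refl arg_cong2[where f = "(*)"] prod.cong) auto

lemma mval_contr_upd: "mval_contr a i (z(i := w)) = mval_contr a i z"
  unfolding mval_contr_def
  by (intro sum.cong refl arg_cong2[where f = "(*)"] prod.cong) auto

text \<open>A negative value would put the root \<open>- G / H\<close> in the upper half-plane;
  moving only coordinate \<open>i\<close> there leaves \<open>G\<close> and \<open>H\<close>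
  unchanged, so the polynomial would vanish on the open half-space.\<close>

lemma stable_coeffs_Im_open:
  assumes "stable_coeffs a" and z: "\<And>k. Im (z k) > 0"
  shows "Im (mval_del a i z * cnj (mval_contr a i z)) \<ge> 0"
proof (rule ccontr)
  let ?G = "mval_del a i z" and ?H = "mval_contr a i z"
  assume neg: "\<not> Im (?G * cnj ?H) \<ge> 0"
  then have H: "?H \<noteq> 0" by auto
  define w where "w = - ?G / ?H"
  have "w = - (?G * cnj ?H) / of_real ((norm ?H)\<^sup>2)"
    unfolding w_def complex_norm_square using H by (simp add: divide_simps)
  then have "Im w = - Im (?G * cnj ?H) / (norm ?H)\<^sup>2"
    by (metis Im_divide_of_real uminus_complex.simps(2))
  with neg H have "Im w > 0" by simp
  then have "mval a (z(i := w)) \<noteq> 0"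
    using assms by (auto simp: stable_coeffs_def)
  moreover have "mval a (z(i := w)) = ?G + w * ?H"
    by (subst mval_split[of _ _ i]) (simp add: mval_del_upd mval_contr_upd)
  ultimately show False using H by (simp add: w_def)
qed

text \<open>The test points used later have zero coordinates, so they lie only in the closure of the
  half-space. Adding \<open>e * \<i>\<close> to every coordinate moves them inside, and
  \<open>e\<close> then tends to 0 from the right.\<close>

lemma stable_coeffs_Im:
  assumes "stable_coeffs a" and z: "\<And>k. Im (z k) \<ge> 0"
  shows "Im (mval_del a i z * cnj (mval_contr a i z)) \<ge> 0"
proof -
  define \<phi> where "\<phi> e = Im (mval_del a i (\<lambda>k. z k + of_real e * \<i>) *
    cnj (mval_contr a i (\<lambda>k. z k + of_real e * \<i>)))" for e :: real
  have "continuous_on UNIV \<phi>"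
    unfolding \<phi>_def mval_del_def mval_contr_def by (intro continuous_intros)
  then have "isCont \<phi> 0"
    by (simp add: continuous_on_eq_continuous_at)
  then have "(\<phi> \<longlongrightarrow> \<phi> 0) (at_right 0)"
    unfolding isCont_def using filterlim_at_split by blast
  moreover have "eventually (\<lambda>e. \<phi> e \<ge> 0) (at_right 0)"
    using eventually_at_right_less[of "0::real"]
  proof eventually_elim
    case (elim e)
    then show ?case
      unfolding \<phi>_def using z
      by (intro stable_coeffs_Im_open[OF assms(1)]) (auto intro: add_nonneg_pos)
  qed
  ultimately have "\<phi> 0 \<ge> 0"
    using tendsto_lowerbound trivial_limit_at_right_real by blast
  then show ?thesis by (simp add: \<phi>_def)
qed

text \<open>The map \<open>- 1 / z\<close> preserves the upper half-plane, and the monomial that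
  clears denominators has no zero there.\<close>

lemma stable_coeffs_flip:
  assumes "stable_coeffs a"
  shows "stable_coeffs (flip_coeffs X a)"
  unfolding stable_coeffs_def
proof (intro allI impI)
  fix z :: "'a \<Rightarrow> complex" assume z: "\<forall>i. Im (z i) > 0"
  define w where "w k = (if k \<in> X then - 1 / z k else z k)" for k
  have z0: "z k \<noteq> 0" for k using z[rule_format, of k] by auto
  have "Im (w k) > 0" for k
    using z[rule_format, of k] z0[of k]
    by (auto simp: w_def Im_divide divide_simps sum_power2_gt_zero_iff complex_eq_iff)
  then have "mval a w \<noteq> 0"
    using assms by (auto simp: stable_coeffs_def)
  moreover have "mval (flip_coeffs X a) z = (\<Prod>k\<in>X. z k) * mval a w"
  proof -
    have "(\<Prod>k\<in>X. z k) * mval a w =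
        (\<Sum>S\<in>UNIV. of_real (a S) * ((\<Prod>k\<in>X. z k) * (\<Prod>k\<in>S. w k)))"
      by (simp add: mval_def sum_distrib_left mult_ac)
    \<comment> \<open>On \<open>S \<inter> X\<close> the factors satisfy
      \<open>z k * w k = - 1\<close>; what survives is the monomial of
      \<open>sym_diff S X\<close>.\<close>
    also have "\<dots> = (\<Sum>S\<in>UNIV. of_real (a S) * ((-1) ^ card (S \<inter> X) * (\<Prod>k\<in>sym_diff S X. z k)))"
    proof (rule sum.cong[OF refl], rule arg_cong[where f = "(*) _"])
      fix S :: "'a set"
      have "(\<Prod>k\<in>X. z k) = (\<Prod>k\<in>X - S. z k) * (\<Prod>k\<in>S \<inter> X. z k)"
        by (metis prod.Int_Diff finite Int_commute mult.commute)
      moreover have "(\<Prod>k\<in>S. w k) = (\<Prod>k\<in>S - X. z k) * (\<Prod>k\<in>S \<inter> X. w k)"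
      proof -
        have "(\<Prod>k\<in>S - X. w k) = (\<Prod>k\<in>S - X. z k)"
          by (intro prod.cong) (auto simp: w_def)
        then show ?thesis by (metis prod.Int_Diff finite mult.commute)
      qed
      moreover have "(\<Prod>k\<in>sym_diff S X. z k) = (\<Prod>k\<in>S - X. z k) * (\<Prod>k\<in>X - S. z k)"
        by (subst prod.union_disjoint[symmetric]) auto
      moreover have "(\<Prod>k\<in>S \<inter> X. z k) * (\<Prod>k\<in>S \<inter> X. w k) = (-1) ^ card (S \<inter> X)"
        unfolding prod.distrib[symmetric] using z0 by (simp add: w_def)
      moreover have "p * q * (r * s) = q * s * (r * p)" for p q r s :: complex
        by (simp add: mult_ac)
      ultimately show "(\<Prod>k\<in>X. z k) * (\<Prod>k\<in>S. w k) =
          (-1) ^ card (S \<inter> X) * (\<Prod>k\<in>sym_diff S X. z k)"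
        by metis
    qed
    also have "\<dots> = mval (flip_coeffs X a) z"
      unfolding mval_def
    proof (rule sum.reindex_bij_witness[of _ "\<lambda>T. sym_diff T X" "\<lambda>S. sym_diff S X"])
      fix S :: "'a set"
      have "sym_diff (sym_diff S X) X = S" "X - sym_diff S X = S \<inter> X" by auto
      then have "flip_coeffs X a (sym_diff S X) = (-1) ^ card (S \<inter> X) * a S"
        by (metis flip_coeffs_def)
      then show "complex_of_real (flip_coeffs X a (sym_diff S X)) * prod z (sym_diff S X) =
         of_real (a S) * ((-1) ^ card (S \<inter> X) * (\<Prod>k\<in>sym_diff S X. z k))"
        by simp
    qed auto
    finally show ?thesis ..
  qed
  ultimately show "mval (flip_coeffs X a) z \<noteq> 0"
    using z0 by simp
qed

section \<open>Rayleigh inequalities for coefficients\<close>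

lemma stable_coeffs_rayleigh_0:
  assumes "stable_coeffs a" and "i \<noteq> j"
  shows "a {i} * a {j} \<ge> a {} * a {i, j}"
proof -
  \<comment> \<open>Only the terms of \<open>{}\<close> and \<open>{j}\<close> survive here, so
    \<open>G = a {} + a {j} * \<i>\<close> and \<open>H = a {i} + a {i, j} * \<i>\<close>. The
    imaginary part of \<open>G * cnj H\<close> is exactly the difference of the two sides.\<close>
  define z where "z = (\<lambda>_. 0)(j := \<i>)"
  have z: "(\<Prod>k\<in>S. z k) = 0" if "S \<notin> {{}, {j}}" for S
  proof -
    from that obtain k where "k \<in> S" "k \<noteq> j" by auto
    then show ?thesis by (auto simp: z_def intro!: prod_zero)
  qed
  have *: "(\<Sum>S | i \<notin> S. of_real (b S) * (\<Prod>k\<in>S. z k)) = of_real (b {}) + of_real (b {j}) * \<i>"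
    for b :: "'a set \<Rightarrow> real"
  proof -
    have "(\<Sum>S | i \<notin> S. of_real (b S) * (\<Prod>k\<in>S. z k)) =
        (\<Sum>S\<in>{{}, {j}}. of_real (b S) * (\<Prod>k\<in>S. z k))"
      using z assms(2) by (intro sum.mono_neutral_right) auto
    then show ?thesis by (simp add: z_def)
  qed
  have "Im (mval_del a i z * cnj (mval_contr a i z)) \<ge> 0"
    by (intro stable_coeffs_Im assms(1)) (simp add: z_def)
  then show ?thesis
    unfolding mval_del_def mval_contr_def * by (simp add: algebra_simps)
qed

text \<open>Flipping along \<open>S\<close> moves \<open>S\<close> to the origin. As
  \<open>i\<close> and \<open>j\<close> lie outside \<open>S\<close>, all four coefficients acquire
  the same sign, which cancels in the products.\<close>

lemma stable_coeffs_rayleigh: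
  assumes "stable_coeffs a" and "i \<noteq> j" "i \<notin> S" "j \<notin> S"
  shows "a (insert i S) * a (insert j S) \<ge> a S * a (insert i (insert j S))"
proof -
  have "flip_coeffs S a T = (-1) ^ card S * a (T \<union> S)" if "T \<subseteq> {i, j}" for T
  proof -
    have "S - T = S" "sym_diff T S = T \<union> S" using that assms by auto
    then show ?thesis by (simp add: flip_coeffs_def)
  qed
  then have "flip_coeffs S a {i} * flip_coeffs S a {j} = a (insert i S) * a (insert j S)"
    "flip_coeffs S a {} * flip_coeffs S a {i, j} = a S * a (insert i (insert j S))"
    by (cases "even (card S)"; simp)+
  then show ?thesis
    using stable_coeffs_rayleigh_0[OF stable_coeffs_flip[OF assms(1), of S] assms(2)]
    by simp
qed

section \<open>The exchange axiom\<close>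

lemma poly_Im_sign_change:
  fixes g h :: "complex poly"
  assumes nonneg: "\<And>t. Im t \<ge> 0 \<Longrightarrow> Im (poly g t * cnj (poly h t)) \<ge> 0"
    and g0: "coeff g 0 = of_real c" "c \<noteq> 0"
    and h: "h \<noteq> 0" "coeff h 0 = 0" "coeff h 1 = 0" "\<And>n. coeff h n \<in> \<real>"
  shows False
proof -
  \<comment> \<open>With \<open>k\<close> the order of vanishing of \<open>h\<close> at 0 and
    \<open>d\<close> its lowest nonzero coefficient, \<open>g * cnj h\<close> behaves like
    \<open>c * d * r ^ k * cis (- k * \<theta>)\<close> near 0 on the ray of angle
    \<open>\<theta>\<close>.\<close>
  define k where "k = (LEAST n. coeff h n \<noteq> 0)"
  have ex: "\<exists>n. coeff h n \<noteq> 0" using h(1) by (auto simp: poly_eq_iff)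
  have hk: "coeff h k \<noteq> 0" unfolding k_def by (rule LeastI_ex[OF ex])
  have hlt: "coeff h n = 0" if "n < k" for n
    using not_less_Least that unfolding k_def by blast
  have k: "k \<ge> 2" using hk h(2,3) by (metis One_nat_def less_2_cases not_less)
  have "monom 1 k dvd h" using hlt by (subst monom_1_dvd_iff') auto
  then obtain q where q: "h = monom 1 k * q" by (elim dvdE)
  have "coeff h k = coeff q 0" by (simp add: q coeff_monom_mult)
  then obtain d where d: "coeff q 0 = of_real d" "d \<noteq> 0"
    using h(4)[of k] hk by (auto elim!: Reals_cases)
  have *: "c * d * sin (real k * \<theta>) \<le> 0" if "0 \<le> \<theta>" "\<theta> \<le> pi" for \<theta>
  proof -
    \<comment> \<open>The positive factor \<open>r ^ k\<close> is divided out, so that the limit at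
      \<open>r = 0\<close> is the informative value
      \<open>- c * d * sin (k * \<theta>)\<close>.\<close>
    define \<phi> where "\<phi> r = Im (poly g (of_real r * cis \<theta>) *
      cnj (poly q (of_real r * cis \<theta>) * cis (real k * \<theta>)))" for r :: real
    have "continuous_on UNIV \<phi>"
      unfolding \<phi>_def by (intro continuous_intros)
    then have "isCont \<phi> 0"
      by (simp add: continuous_on_eq_continuous_at)
    then have "(\<phi> \<longlongrightarrow> \<phi> 0) (at_right 0)"
      unfolding isCont_def using filterlim_at_split by blast
    moreover have "eventually (\<lambda>e. \<phi> e \<ge> 0) (at_right 0)"
      using eventually_at_right_less[of "0::real"]
    proof eventually_elim
      case (elim r)
      have "poly h (of_real r * cis \<theta>) =
          of_real (r ^ k) * (poly q (of_real r * cis \<theta>) * cis (real k * \<theta>))"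
        by (simp add: q poly_monom power_mult_distrib Complex.DeMoivre)
      then have "Im (poly g (of_real r * cis \<theta>) * cnj (poly h (of_real r * cis \<theta>))) = r ^ k * \<phi> r"
        by (simp add: \<phi>_def algebra_simps del: of_real_power)
      moreover have "Im (of_real r * cis \<theta>) \<ge> 0"
        using elim that by (simp add: sin_ge_zero)
      ultimately have "r ^ k * \<phi> r \<ge> 0" using nonneg by metis
      then show ?case using elim zero_less_power[OF elim, of k] by (auto simp: zero_le_mult_iff)
    qed
    ultimately have "\<phi> 0 \<ge> 0"
      using tendsto_lowerbound trivial_limit_at_right_real by blast
    then show ?thesis using g0 d by (simp add: \<phi>_def poly_0_coeff_0)
  qed
  \<comment> \<open>Because \<open>k \<ge> 2\<close>, both \<open>pi / (2 * k)\<close> and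
    \<open>3 * pi / (2 * k)\<close> lie in the admissible range from 0 to \<open>pi\<close>. The
    sine takes the values 1 and -1 there, forcing \<open>c * d = 0\<close>.\<close>
  have "c * d \<le> 0" using *[of "pi / 2 / real k"] k by (simp add: field_simps)
  moreover have "sin (3 * pi / 2) = - 1" using sin_3over2_pi by simp
  then have "c * d \<ge> 0" using *[of "3 * pi / 2 / real k"] k by (simp add: field_simps)
  ultimately show False using g0 d by simp
qed

text \<open>If the exchange fails, the choice \<open>j = i\<close> kills the constant term of the
  restricted contraction and the other \<open>j\<close> kill its linear term, while
  \<open>a Y\<close> keeps it nonzero and \<open>a {}\<close> keeps the deletion nonzero at
  0.\<close>

lemma stable_coeffs_exchange_0:
  assumes st: "stable_coeffs a" and a0: "a {} \<noteq> 0" and aY: "a Y \<noteq> 0" and i: "i \<in> Y"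
  shows "\<exists>j\<in>Y. a {i, j} \<noteq> 0"
proof (rule ccontr)
  assume "\<not> ?thesis"
  then have zero: "a {i, j} = 0" if "j \<in> Y" for j using that by auto
  \<comment> \<open>Putting \<open>t\<close> on \<open>Y\<close> and 0 elsewhere leaves only the
    sets in \<open>P\<close>, each contributing a power of \<open>t\<close>. Then \<open>p a\<close>
    is the restricted deletion and \<open>p\<close> of the shifted family is the restricted
    contraction.\<close>
  define P where "P = Pow (Y - {i})"
  define p where "p b = (\<Sum>S\<in>P. monom (complex_of_real (b S)) (card S))" for b :: "'a set \<Rightarrow> real"
  have eval: "(\<Sum>S | i \<notin> S. of_real (b S) * (\<Prod>k\<in>S. if k \<in> Y then t else 0)) = poly (p b) t"
    for b :: "'a set \<Rightarrow> real" and t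
  proof -
    have "(\<Sum>S | i \<notin> S. of_real (b S) * (\<Prod>k\<in>S. if k \<in> Y then t else 0)) =
       (\<Sum>S\<in>P. of_real (b S) * (\<Prod>k\<in>S. if k \<in> Y then t else 0))"
      by (intro sum.mono_neutral_right) (auto simp: P_def)
    also have "\<dots> = (\<Sum>S\<in>P. of_real (b S) * t ^ card S)"
    proof (intro sum.cong refl arg_cong2[where f = "(*)"])
      fix S assume "S \<in> P"
      then have "(\<Prod>k\<in>S. if k \<in> Y then t else 0) = (\<Prod>k\<in>S. t)"
        by (intro prod.cong) (auto simp: P_def)
      then show "(\<Prod>k\<in>S. if k \<in> Y then t else 0) = t ^ card S" by simp
    qed
    finally show ?thesis by (simp add: p_def poly_sum poly_monom)
  qed
  have coeff_p: "coeff (p b) n = (\<Sum>S\<in>{S\<in>P. card S = n}. of_real (b S))" for b n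
    unfolding p_def coeff_sum coeff_monom
    by (subst sum.inter_filter) (auto simp: P_def)
  let ?c = "\<lambda>S. a (insert i S)"
  have card0: "{S\<in>P. card S = 0} = {{}}" by (auto simp: P_def)
  \<comment> \<open>Several sets of equal cardinality could cancel in a coefficient; in the top
    degree there is just one, so \<open>a Y\<close> survives.\<close>
  have top: "{S\<in>P. card S = card (Y - {i})} = {Y - {i}}"
    using card_subset_eq[of "Y - {i}"] by (auto simp only: P_def Pow_iff finite)
  show False
  proof (rule poly_Im_sign_change[of "p a" "p ?c" "a {}"])
    fix t :: complex assume t: "Im t \<ge> 0"
    have "Im (mval_del a i (\<lambda>k. if k \<in> Y then t else 0) *
        cnj (mval_contr a i (\<lambda>k. if k \<in> Y then t else 0))) \<ge> 0"
      using t by (intro stable_coeffs_Im st) simp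
    then show "Im (poly (p a) t * cnj (poly (p ?c) t)) \<ge> 0"
      unfolding mval_del_def mval_contr_def eval .
  next
    have "coeff (p ?c) (card (Y - {i})) = of_real (a Y)"
      unfolding coeff_p top using i by (simp add: insert_absorb)
    then show "p ?c \<noteq> 0" using aY by auto
  next
    show "coeff (p ?c) 1 = 0"
      unfolding coeff_p
    proof (rule sum.neutral, safe)
      fix S assume "S \<in> P" "card S = 1"
      then obtain j where "S = {j}" "j \<in> Y" by (auto simp: P_def card_1_singleton_iff)
      then show "complex_of_real (?c S) = 0" using zero by auto
    qed
  next
    show "coeff (p ?c) n \<in> \<real>" for n unfolding coeff_p by (intro sum_in_Reals) auto
  next
    show "coeff (p a) 0 = of_real (a {})" unfolding coeff_p card0 by simp
  next
    show "coeff (p ?c) 0 = 0" unfolding coeff_p card0 using zero[OF i] by simp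
  qed (rule a0)
qed

text \<open>Flipping along \<open>X\<close> turns \<open>X\<close> into the empty set and
  \<open>Y\<close> into \<open>sym_diff X Y\<close>; the signs introduced do not affect which
  coefficients vanish.\<close>

lemma stable_coeffs_delta_matroid:
  assumes st: "stable_coeffs a" and a0: "a {} \<noteq> 0"
  shows "delta_matroid {S. a S \<noteq> 0}"
  unfolding delta_matroid_def
proof (intro conjI ballI)
  show "{S. a S \<noteq> 0} \<noteq> {}" using a0 by auto
next
  fix X Y i assume XY: "X \<in> {S. a S \<noteq> 0}" "Y \<in> {S. a S \<noteq> 0}" and i: "i \<in> sym_diff X Y"
  have *: "flip_coeffs X a T \<noteq> 0 \<longleftrightarrow> a (sym_diff X T) \<noteq> 0" for T
    by (simp add: flip_coeffs_def Un_commute)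
  have "sym_diff X (sym_diff X Y) = Y" by auto
  then have "\<exists>j\<in>sym_diff X Y. flip_coeffs X a {i, j} \<noteq> 0"
    using XY i by (intro stable_coeffs_exchange_0 stable_coeffs_flip st) (simp_all only: *, auto)
  then show "\<exists>j\<in>sym_diff X Y. sym_diff X {i, j} \<in> {S. a S \<noteq> 0}"
    by (simp only: * mem_Collect_eq)
qed

section \<open>From multiaffine polynomials to coefficient families\<close>

lemma lookup_sqfree_exponent:
  "Poly_Mapping.lookup (sqfree_exponent (S::'n::finite set)) i = (if i \<in> S then 1 else 0)"
  by (simp add: sqfree_exponent_def lookup_sum lookup_single when_def)

lemma keys_sqfree_exponent: "Poly_Mapping.keys (sqfree_exponent (S::'n::finite set)) = S"
  by (auto simp: in_keys_iff lookup_sqfree_exponent split: if_splits)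

lemma inj_sqfree_exponent: "inj (sqfree_exponent :: 'n::finite set \<Rightarrow> _)"
  by (metis injI keys_sqfree_exponent)

lemma multiaffine_keys:
  fixes f :: "('n::finite, 'a::zero) mpolynomial"
  assumes "multiaffine f"
  shows "Poly_Mapping.keys f \<subseteq> range sqfree_exponent"
proof
  fix m assume m: "m \<in> Poly_Mapping.keys f"
  have "m = sqfree_exponent (Poly_Mapping.keys m)"
  proof (rule poly_mapping_eqI)
    fix i
    have "Poly_Mapping.lookup m i \<le> 1" using assms m by (auto simp: multiaffine_def)
    then show "Poly_Mapping.lookup m i = Poly_Mapping.lookup (sqfree_exponent (Poly_Mapping.keys m)) i"
      by (auto simp: lookup_sqfree_exponent in_keys_iff)
  qed
  then show "m \<in> range sqfree_exponent" by blast
qed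

lemma mpoly_eval_multiaffine:
  fixes f :: "('n::finite, real) mpolynomial"
  assumes "multiaffine f"
  shows "mpoly_eval (Poly_Mapping.map complex_of_real f) z = mval (coeff_of f) z"
proof -
  let ?f = "Poly_Mapping.map complex_of_real f"
  have lk: "Poly_Mapping.lookup ?f m = of_real (Poly_Mapping.lookup f m)" for m
    by (simp add: map.rep_eq when_def)
  have "Poly_Mapping.keys ?f = Poly_Mapping.keys f"
    by (auto simp: in_keys_iff lk)
  then have "Poly_Mapping.keys ?f \<subseteq> range sqfree_exponent"
    using multiaffine_keys[OF assms] by simp
  then have "mpoly_eval ?f z = (\<Sum>m\<in>range sqfree_exponent.
      Poly_Mapping.lookup ?f m * (\<Prod>i\<in>Poly_Mapping.keys m. z i ^ Poly_Mapping.lookup m i))"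
    unfolding mpoly_eval_def by (intro sum.mono_neutral_left) (auto simp: in_keys_iff)
  also have "\<dots> = mval (coeff_of f) z"
    by (subst sum.reindex[OF inj_sqfree_exponent])
      (simp add: mval_def lk coeff_of_def keys_sqfree_exponent lookup_sqfree_exponent)
  finally show ?thesis .
qed

section \<open>Faces of the cube and of the base polytope\<close>

lemma inj_indicator_vec: "indicator_vec S = indicator_vec T \<longleftrightarrow> S = T"
proof
  assume "indicator_vec S = indicator_vec T"
  then have "(if i \<in> S then 1 else 0) = (if i \<in> T then 1 else (0::real))" for i
    by (simp add: indicator_vec_def vec_eq_iff)
  then show "S = T" by (metis subsetI subset_antisym zero_neq_one)
qed simp

lemma midpoint_indicator_vec_eq:
  assumes "A \<inter> B = C \<inter> D" "A \<union> B = C \<union> D"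
  shows "midpoint (indicator_vec A) (indicator_vec B) = midpoint (indicator_vec C) (indicator_vec D)"
proof -
  have "(if i \<in> A then 1 else 0) + (if i \<in> B then 1 else 0) =
      (if i \<in> C then 1 else 0) + (if i \<in> D then 1 else (0::real))" for i
  proof -
    have "i \<in> A \<and> i \<in> B \<longleftrightarrow> i \<in> C \<and> i \<in> D" "i \<in> A \<or> i \<in> B \<longleftrightarrow> i \<in> C \<or> i \<in> D"
      using assms by auto
    then show ?thesis by auto
  qed
  then show ?thesis
    by (auto simp: midpoint_def vec_eq_iff indicator_vec_def)
qed

text \<open>The segments from \<open>A\<close> to \<open>B\<close> and from \<open>C\<close> to
  \<open>D\<close> share their midpoint. It lies in the face and in the open segment between
  \<open>C\<close> and \<open>D\<close>, so the face contains both ends of that segment.\<close>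

lemma face_of_indicator_vec_interval:
  assumes Q: "Q face_of P" and "convex Q" and AB: "indicator_vec A \<in> Q" "indicator_vec B \<in> Q"
    and CD: "indicator_vec C \<in> P" "indicator_vec D \<in> P"
    and eq: "A \<inter> B = C \<inter> D" "A \<union> B = C \<union> D"
  shows "indicator_vec C \<in> Q"
proof (cases "C = D")
  case True
  then have "A = C" using eq by auto
  then show ?thesis using AB by simp
next
  case False
  then have "midpoint (indicator_vec A) (indicator_vec B) \<in> open_segment (indicator_vec C) (indicator_vec D)"
    by (simp add: midpoint_indicator_vec_eq[OF eq] inj_indicator_vec)
  moreover have "midpoint (indicator_vec A) (indicator_vec B) \<in> Q"
    using AB \<open>convex Q\<close> by (meson closed_segment_subset midpoint_in_closed_segment subsetD)
  ultimately show ?thesis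
    using Q CD by (auto simp: face_of_def)
qed

lemma indicator_vec_extreme_point_of_cbox: "indicator_vec S extreme_point_of cbox 0 1"
  unfolding extreme_point_of_def
proof (intro conjI ballI)
  show "indicator_vec S \<in> cbox 0 1" by (simp add: mem_box_cart indicator_vec_def)
next
  fix a b :: "real ^ 'a" assume ab: "a \<in> cbox 0 1" "b \<in> cbox 0 1"
  show "indicator_vec S \<notin> open_segment a b"
  proof
    assume "indicator_vec S \<in> open_segment a b"
    then obtain u where "a \<noteq> b" and u: "0 < u" "u < 1"
      and eq: "indicator_vec S = (1 - u) *\<^sub>R a + u *\<^sub>R b"
      by (auto simp: in_segment)
    have "a $ i = b $ i" for i
    proof -
      have rng: "0 \<le> a $ i" "a $ i \<le> 1" "0 \<le> b $ i" "b $ i \<le> 1"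
        using ab by (auto simp: mem_box_cart)
      have e: "(if i \<in> S then 1 else 0) = (1 - u) * a $ i + u * b $ i"
        using arg_cong[OF eq, of "\<lambda>x. x $ i"] by (simp add: indicator_vec_def)
      show ?thesis
      \<comment> \<open>The coordinate is an end of the unit interval, so its distance to that end
        is a positively weighted sum of nonnegative terms equal to 0.\<close>
      proof (cases "i \<in> S")
        case True
        then have "(1 - u) * (1 - a $ i) + u * (1 - b $ i) = 0" using e by (simp add: algebra_simps)
        then have "(1 - u) * (1 - a $ i) = 0 \<and> u * (1 - b $ i) = 0"
          using rng u by (subst (asm) add_nonneg_eq_0_iff) auto
        then show ?thesis using u by auto
      next
        case False
        then have "(1 - u) * a $ i = 0 \<and> u * b $ i = 0"
          using e rng u by (subst add_nonneg_eq_0_iff[symmetric]) auto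
        then show ?thesis using u by auto
      qed
    qed
    with \<open>a \<noteq> b\<close> show False by (simp add: vec_eq_iff)
  qed
qed

lemma face_vertices_eq:
  assumes "Q face_of cbox 0 1"
  shows "face_vertices Q = {S. indicator_vec S \<in> Q}"
  using indicator_vec_extreme_point_of_cbox
  by (auto simp: face_vertices_def extreme_point_of_face[OF assms])

lemma face_vertices_interval:
  assumes Q: "Q face_of cbox 0 1" and "A \<in> face_vertices Q" "B \<in> face_vertices Q"
    and "A \<inter> B \<subseteq> C" "C \<subseteq> A \<union> B"
  shows "C \<in> face_vertices Q"
proof -
  have "indicator_vec S \<in> cbox 0 1" for S :: "'a set"
    using indicator_vec_extreme_point_of_cbox by (auto simp: extreme_point_of_def)
  \<comment> \<open>The partner of \<open>C\<close> is its complement inside the interval from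
    \<open>A \<inter> B\<close> to \<open>A \<union> B\<close>.\<close>
  moreover have "A \<inter> B = C \<inter> (A \<inter> B \<union> (A \<union> B - C))" "A \<union> B = C \<union> (A \<inter> B \<union> (A \<union> B - C))"
    using assms(4,5) by auto
  ultimately show ?thesis
    using assms(2,3) face_of_indicator_vec_interval[OF Q face_of_imp_convex[OF Q]]
    unfolding face_vertices_eq[OF Q] mem_Collect_eq by blast
qed

text \<open>Translating \<open>L\<close> to the origin turns the other vertices into distinct
  standard basis vectors, which are independent.\<close>

lemma card_le_aff_dim_indicator_vec:
  assumes "indicator_vec L \<in> Q" "\<And>k. k \<in> K \<Longrightarrow> indicator_vec (insert k L) \<in> Q" and "K \<inter> L = {}"
  shows "int (card K) \<le> aff_dim Q"
proof -
  let ?B = "(\<lambda>k. axis k (1::real)) ` K"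
  have "?B \<subseteq> (+) (- indicator_vec L) ` Q"
  proof safe
    fix k assume k: "k \<in> K"
    then have "axis k 1 = - indicator_vec L + indicator_vec (insert k L)"
      using assms(3) by (auto simp: vec_eq_iff axis_def indicator_vec_def)
    then show "axis k 1 \<in> (+) (- indicator_vec L) ` Q" using assms(2)[OF k] by blast
  qed
  moreover have "independent ?B"
    by (rule independent_mono[OF independent_Basis]) (auto simp: Basis_vec_def)
  ultimately have "card ?B \<le> dim ((+) (- indicator_vec L) ` Q)"
    by (rule independent_card_le_dim)
  moreover have "card ?B = card K"
    by (intro card_image) (auto simp: inj_on_def axis_eq_axis)
  moreover have "aff_dim Q = int (dim ((+) (- indicator_vec L) ` Q))"
    by (intro aff_dim_eq_dim hull_inc assms(1))
  ultimately show ?thesis by simp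
qed

text \<open>This describes a vertex that is neither closest to nor furthest from the empty set. The
  face contains a whole interval from \<open>L\<close> to \<open>U\<close> around it, dimension two
  gives \<open>card (U - L) \<le> 2\<close>, and the strict inequalities leave one element on each
  side of \<open>A\<close>.\<close>

lemma two_face_between:
  assumes Q: "two_face Q"
    and V: "A \<in> face_vertices Q" "C \<in> face_vertices Q" "D \<in> face_vertices Q"
    and card: "card C < card A" "card A < card D"
  obtains L i j where "i \<noteq> j" "i \<notin> L" "j \<notin> L" "A = insert i L"
    "{L, insert j L, insert i (insert j L)} \<subseteq> face_vertices Q"
proof -
  have face: "Q face_of cbox 0 1" and dim: "aff_dim Q = 2" using Q by (auto simp: two_face_def)
  note between = face_vertices_interval[OF face]
  define L where "L = C \<inter> A \<inter> D"
  define U where "U = C \<union> A \<union> D"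
  have "C \<inter> A \<in> face_vertices Q" "C \<union> A \<in> face_vertices Q"
    by (rule between[OF V(2,1)]; blast)+
  then have LU: "L \<in> face_vertices Q" "U \<in> face_vertices Q"
    unfolding L_def U_def by (auto intro: between[OF _ V(3)])
  have mem: "S \<in> face_vertices Q" if "L \<subseteq> S" "S \<subseteq> U" for S
    using that by (intro between[OF LU]) auto
  have sub: "L \<subseteq> C" "L \<subseteq> A" "A \<subseteq> U" "D \<subseteq> U" by (auto simp: L_def U_def)
  have "int (card (U - L)) \<le> aff_dim Q"
    using mem sub unfolding face_vertices_eq[OF face]
    by (intro card_le_aff_dim_indicator_vec[of L]) auto
  then have "card (U - L) \<le> 2" using dim by simp
  moreover have "card (U - L) = card (U - A) + card (A - L)"
    using sub by (subst card_Un_disjoint[symmetric]) (auto intro: arg_cong[where f = card])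
  moreover have "card (A - L) = card A - card L" "card (U - A) = card U - card A"
    using sub by (auto intro: card_Diff_subset)
  moreover have "card L \<le> card C" "card D \<le> card U" using sub by (auto intro: card_mono)
  ultimately have "card (A - L) = 1" "card (U - A) = 1" using card by linarith+
  then obtain i j where ij: "A - L = {i}" "U - A = {j}" by (auto simp: card_1_singleton_iff)
  show ?thesis
  proof (rule that)
    show "A = insert i L" "i \<noteq> j" "i \<notin> L" "j \<notin> L" using ij sub by auto
    show "{L, insert j L, insert i (insert j L)} \<subseteq> face_vertices Q"
      using ij sub by (intro subsetI mem) auto
  qed
qed

text \<open>Two diagonals of a square cross at their midpoint, so an edge along one would contain
  the ends of the other. The only cube vertices on that edge are its own endpoints.\<close>

lemma long_edge_no_crossing:
  assumes "long_edge \<B> A B" and "C \<in> \<B>" "D \<in> \<B>"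
    and eq: "A \<inter> B = C \<inter> D" "A \<union> B = C \<union> D"
  shows "C = A \<or> C = B"
proof -
  let ?E = "closed_segment (indicator_vec A) (indicator_vec B)"
  have "?E face_of base_polytope \<B>"
    using assms(1) by (auto simp: long_edge_def edge_of_def)
  moreover have "indicator_vec S \<in> base_polytope \<B>" if "S \<in> \<B>" for S
    using that by (auto simp: base_polytope_def intro: hull_inc)
  ultimately have "indicator_vec C \<in> ?E"
    using assms face_of_indicator_vec_interval[of ?E _ A B C D] by auto
  moreover have "?E \<subseteq> cbox 0 1"
    using indicator_vec_extreme_point_of_cbox
    by (intro closed_segment_subset convex_box) (auto simp: extreme_point_of_def)
  then have "indicator_vec C extreme_point_of ?E" if "indicator_vec C \<in> ?E"
    using that indicator_vec_extreme_point_of_cbox[of C] by (auto simp: extreme_point_of_def)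
  ultimately show ?thesis
    by (simp add: extreme_point_of_segment inj_indicator_vec)
qed

section \<open>Signs along long edges\<close>

lemma set_dist_2E:
  assumes "set_dist A B = 2"
  obtains (horizontal) S i j where "i \<noteq> j" "i \<notin> S" "j \<notin> S" "A = insert i S" "B = insert j S"
  | (up) S i j where "i \<noteq> j" "i \<notin> S" "j \<notin> S" "A = S" "B = insert i (insert j S)"
  | (down) S i j where "i \<noteq> j" "i \<notin> S" "j \<notin> S" "B = S" "A = insert i (insert j S)"
proof -
  obtain i j where ij: "sym_diff A B = {i, j}" "i \<noteq> j"
    using assms by (auto simp: set_dist_def card_2_iff)
  define S where "S = A \<inter> B"
  have S: "i \<notin> S" "j \<notin> S" using ij by (auto simp: S_def)
  have A: "A = S \<union> (A \<inter> {i, j})" and B: "B = S \<union> ({i, j} - A)"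
    using ij by (auto simp: S_def)
  consider "i \<in> A" "j \<in> A" | "i \<in> A" "j \<notin> A" | "i \<notin> A" "j \<in> A" | "i \<notin> A" "j \<notin> A" by blast
  then show ?thesis
  proof cases
    case 1
    show ?thesis by (rule down[of i j S]) (use 1 A B S ij(2) in auto)
  next
    case 2
    show ?thesis by (rule horizontal[of i j S]) (use 2 A B S ij(2) in auto)
  next
    case 3
    show ?thesis by (rule horizontal[of j i S]) (use 3 A B S ij(2) in auto)
  next
    case 4
    show ?thesis by (rule up[of i j S]) (use 4 A B S ij(2) in auto)
  qed
qed

text \<open>The Rayleigh inequality compares the products over the two diagonals of a square. The
  long edge is one diagonal; the product over the other is 0 by
  \<open>long_edge_no_crossing\<close>, which fixes the sign of the product along the edge.\<close>

lemma stable_coeffs_long_edge: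
  assumes st: "stable_coeffs a" and edge: "long_edge {S. a S \<noteq> 0} A B"
  shows "sgn (a A) = (if card A = card B then sgn (a B) else - sgn (a B))"
proof -
  have AB: "a A \<noteq> 0" "a B \<noteq> 0" "set_dist A B = 2" using edge by (auto simp: long_edge_def)
  have cross: "a C = 0 \<or> a D = 0"
    if "A \<inter> B = C \<inter> D" "A \<union> B = C \<union> D" "C \<noteq> A" "C \<noteq> B" for C D
    using long_edge_no_crossing[OF edge _ _ that(1,2)] that(3,4) by auto
  have vertical: "a S * a (insert i (insert j S)) \<le> 0"
    if "i \<noteq> j" "i \<notin> S" "j \<notin> S" "a (insert i S) = 0 \<or> a (insert j S) = 0" for S i j
    using stable_coeffs_rayleigh[OF st that(1-3)] that(4) by auto
  from AB(3) show ?thesis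
  proof (cases rule: set_dist_2E)
    case (horizontal S i j)
    then have "a S = 0 \<or> a (insert i (insert j S)) = 0" by (intro cross) auto
    then have "a A * a B \<ge> 0"
      using stable_coeffs_rayleigh[OF st horizontal(1-3)] horizontal(4,5) by auto
    moreover have "card A = card B" using horizontal by simp
    ultimately show ?thesis using AB by (auto simp: sgn_if zero_le_mult_iff)
  next
    case (up S i j)
    then have "a (insert i S) = 0 \<or> a (insert j S) = 0" by (intro cross) auto
    then have "a A * a B \<le> 0" using vertical[OF up(1-3)] up(4,5) by simp
    moreover have "card A \<noteq> card B" using up by simp
    ultimately show ?thesis using AB by (auto simp: sgn_if mult_le_0_iff)
  next
    case (down S i j)
    then have "a (insert i S) = 0 \<or> a (insert j S) = 0" by (intro cross) auto
    then have "a B * a A \<le> 0" using vertical[OF down(1-3)] down(4,5) by simp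
    moreover have "card A \<noteq> card B" using down by simp
    ultimately show ?thesis using AB by (auto simp: sgn_if mult_le_0_iff)
  qed
qed

theorem theorem3p1:
  fixes f :: "('n::finite, real) mpolynomial"
  assumes "multiaffine f"
    and "real_stable (Poly_Mapping.map complex_of_real f)"
    and "coeff_of f {} > 0"
  shows "is_orientation (supp f) {} (\<lambda>S. sgn (coeff_of f S))"
proof -
  let ?a = "coeff_of f"
  have st: "stable_coeffs ?a"
    using assms(2) by (simp add: real_stable_def stable_def stable_coeffs_def
        mpoly_eval_multiaffine[OF assms(1)])
  have dist: "set_dist S {} = card S" for S :: "'n set" by (simp add: set_dist_def)
  show ?thesis
    unfolding is_orientation_def
  proof (intro conjI allI impI ballI)
    show "{} \<in> supp f" using assms(3) by (simp add: supp_def)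
    show "sgn (?a S) \<in> {1, - 1}" if "S \<in> supp f" for S
      using that by (auto simp: supp_def sgn_if)
    show "delta_matroid (supp f)"
      unfolding supp_def using assms(3) by (intro stable_coeffs_delta_matroid st) simp
    show "sgn (?a A) = sgn (?a B)" if "horizontal_edge (supp f) {} A B" for A B
      using that stable_coeffs_long_edge[OF st, of A B]
      by (simp add: horizontal_edge_def supp_def dist)
    show "sgn (?a A) = - sgn (?a B)" if "vertical_edge (supp f) {} A B" for A B
      using that stable_coeffs_long_edge[OF st, of A B]
      by (simp add: vertical_edge_def supp_def dist)
    show "sgn (?a {}) = 1" using assms(3) by simp
  next
    fix Q :: "(real ^ 'n) set" and A :: "'n set"
    assume Q: "two_face Q \<and> face_vertices Q \<subseteq> supp f" and A: "A \<in> face_vertices Q"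
      and opp: "\<forall>C\<in>face_vertices Q - {A}. sgn (?a C) = - sgn (?a A)"
    show "(\<forall>C\<in>face_vertices Q. set_dist A {} \<le> set_dist C {}) \<or>
        (\<forall>C\<in>face_vertices Q. set_dist C {} \<le> set_dist A {})"
    proof (rule ccontr)
      assume "\<not> ?thesis"
      then obtain C D where "C \<in> face_vertices Q" "D \<in> face_vertices Q" "card C < card A" "card A < card D"
        by (auto simp: dist not_le)
      then obtain L i j where L: "i \<noteq> j" "i \<notin> L" "j \<notin> L" and AL: "A = insert i L"
        and V: "{L, insert j L, insert i (insert j L)} \<subseteq> face_vertices Q"
        using two_face_between[of Q A C D] Q A by metis
      have "L \<noteq> A" "insert j L \<noteq> A" "insert i (insert j L) \<noteq> A" using L AL by auto
      \<comment> \<open>The odd sign sits at the middle vertex \<open>insert i L\<close>, making the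
        product over the middle diagonal negative and the one over the other diagonal positive,
        contrary to the Rayleigh inequality at \<open>L\<close>.\<close>
      then have "sgn (?a L) = - sgn (?a A)" "sgn (?a (insert j L)) = - sgn (?a A)"
        "sgn (?a (insert i (insert j L))) = - sgn (?a A)" using V opp by auto
      moreover have "?a A \<noteq> 0" using A Q by (auto simp: supp_def)
      ultimately have "?a (insert i L) * ?a (insert j L) < 0"
        "?a L * ?a (insert i (insert j L)) > 0"
        unfolding AL by (auto simp: sgn_if mult_less_0_iff zero_less_mult_iff split: if_splits)
      then show False using stable_coeffs_rayleigh[OF st L] by linarith
    qed
  qed
qed

end
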